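(* Let $d\ge1$, $\alpha\in(0,2)$, and let $V:\mathbb{R}^d\to\mathbb{R}$ be a locally bounded Borel measurable function with $e^{-V}\in L^1(dx)$. There is a constant $C_3>0$ such that for each $r>1$ and $f\in C_b^\infty(\mathbb{R}^d)$, $$\begin{aligned}\int_{B(0,r)}&\bigg(f(x)-\frac{\int_{B(0,r)}f(x)\,\mu_V(dx)}{\mu_V(B(0,r))}\bigg)^2\mu_V(dx)\\&\le\frac{C_3K(r)r^{3d}}{k(r)}\iint_{B(0,r+1)\times B(0,r+1)}\frac{(f(x)-f(y))^2}{|x-y|^{d+\alpha}}\mathbf{1}_{\{|x-y|\le1\}}\,dy\,\mu_V(dx)\\&\le\frac{C_3K(r)r^{3d}}{k(r)}\,\mathscr{E}_{\alpha,V}(f,f).\end{aligned}$$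
   Context: $C_b^\infty(\mathbb{R}^d)$ is the set of smooth functions with bounded derivatives of every order. $B(x,r)$ is the ball with center $x$ and radius $r$. $\mu_V(dx)=C_Ve^{-V(x)}\,dx$ with $C_V=\big(\int e^{-V(x)}dx\big)^{-1}$ is a probability measure. For $r>0$, $k(r):=\inf_{|x|\le r+1}e^{-V(x)}$ and $K(r):=\sup_{|x|\le r}e^{-V(x)}$. The form is $$\mathscr{E}_{\alpha,V}(f,f):=\frac12\iint_{\{|x-y|\le 1\}}\frac{(f(x)-f(y))^2}{|x-y|^{d+\alpha}}\,dy\,\mu_V(dx).$$
   Formalization: The second inequality, false as printed because the form carries a factor 1/2 (take f supported in B(0,r)), is proved with an extra factor 2 on its right side; the first inequality and the bound of the first expression by the last hold with the same C_3 as printed. *)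

theory Defs
  imports "HOL-Analysis.Analysis"
begin

definition locally_bounded :: "('a::topological_space \<Rightarrow> 'b::metric_space) \<Rightarrow> bool" where
  "locally_bounded V \<longleftrightarrow> (\<forall>x. \<exists>U. open U \<and> x \<in> U \<and> bounded (V ` U))"

primrec iterated_partial :: "'n list \<Rightarrow> (real ^ 'n \<Rightarrow> real) \<Rightarrow> real ^ 'n \<Rightarrow> real" where
  "iterated_partial [] f = f"
| "iterated_partial (j # js) f =
     (\<lambda>x. frechet_derivative (iterated_partial js f) (at x) (axis j 1))"

(* Every iterated partial derivative is required to be Frechet differentiable everywhere;
   hence all of them are continuous and f is of class C^infinity. The empty list is included,
   so f itself is bounded. *)
definition Cb_infinity :: "(real ^ 'n \<Rightarrow> real) set" where
  "Cb_infinity = {f. \<forall>js. (\<forall>x. iterated_partial js f differentiable (at x)) \<and>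
                          bounded (range (iterated_partial js f))}"

definition gibbs_const :: "(real ^ 'n \<Rightarrow> real) \<Rightarrow> real" where
  "gibbs_const V = inverse (LINT x|lborel. exp (- V x))"

definition gibbs_measure :: "(real ^ 'n \<Rightarrow> real) \<Rightarrow> (real ^ 'n) measure" where
  "gibbs_measure V = density lborel (\<lambda>x. ennreal (gibbs_const V * exp (- V x)))"

definition k_inf :: "(real ^ 'n \<Rightarrow> real) \<Rightarrow> real \<Rightarrow> real" where
  "k_inf V r = (INF x\<in>{x. norm x \<le> r + 1}. exp (- V x))"

definition K_sup :: "(real ^ 'n \<Rightarrow> real) \<Rightarrow> real \<Rightarrow> real" where
  "K_sup V r = (SUP x\<in>{x. norm x \<le> r}. exp (- V x))"

(* On the diagonal the value is 0 (division by zero), which is immaterial since the diagonal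
   is a null set. *)
definition jump_quotient ::
    "real \<Rightarrow> (real ^ 'n \<Rightarrow> real) \<Rightarrow> real ^ 'n \<Rightarrow> real ^ 'n \<Rightarrow> real" where
  "jump_quotient \<alpha> f x y =
     (f x - f y)\<^sup>2 / norm (x - y) powr (real CARD('n) + \<alpha>) * indicator {y. norm (x - y) \<le> 1} y"

(* Integrals of nonnegative functions are taken in the extended nonnegative reals, so that no
   integrability convention enters. Only the quadratic form f \<mapsto> E(f,f) is defined. *)
definition dirichlet_form ::
    "real \<Rightarrow> (real ^ 'n \<Rightarrow> real) \<Rightarrow> (real ^ 'n \<Rightarrow> real) \<Rightarrow> ennreal" where
  "dirichlet_form \<alpha> V f =
     ennreal (1 / 2) *
     (\<integral>\<^sup>+ x. (\<integral>\<^sup>+ y. ennreal (jump_quotient \<alpha> f x y) \<partial>lborel) \<partial>gibbs_measure V)"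

(* The double integral over B(0,R) x B(0,R), without the factor 1/2 of the Dirichlet form:
   it is at most 2 * dirichlet_form, with equality if f vanishes outside B(0,R-1). *)
definition local_energy ::
    "real \<Rightarrow> (real ^ 'n \<Rightarrow> real) \<Rightarrow> real \<Rightarrow> (real ^ 'n \<Rightarrow> real) \<Rightarrow> ennreal" where
  "local_energy \<alpha> V R f =
     (\<integral>\<^sup>+ x \<in> ball 0 R.
       (\<integral>\<^sup>+ y \<in> ball 0 R. ennreal (jump_quotient \<alpha> f x y) \<partial>lborel) \<partial>gibbs_measure V)"

definition ball_mean :: "(real ^ 'n \<Rightarrow> real) \<Rightarrow> real \<Rightarrow> (real ^ 'n \<Rightarrow> real) \<Rightarrow> real" where
  "ball_mean V r f =
     (LINT x:ball 0 r|gibbs_measure V. f x) / measure (gibbs_measure V) (ball 0 r)"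

definition local_variance :: "(real ^ 'n \<Rightarrow> real) \<Rightarrow> real \<Rightarrow> (real ^ 'n \<Rightarrow> real) \<Rightarrow> ennreal" where
  "local_variance V r f =
     (\<integral>\<^sup>+ x \<in> ball 0 r. ennreal ((f x - ball_mean V r f)\<^sup>2) \<partial>gibbs_measure V)"

end

theory Submission
  imports Defs
begin

text \<open>
  The mean minimises the quadratic deviation, so the variance over the ball is at most
  the quadratic deviation from \<open>f y\<close> for every \<open>y\<close>; averaging over \<open>y\<close> with respect to Lebesgue
  measure bounds it by the double integral of \<open>(f x - f y)\<^sup>2\<close> over the ball.
  Inserting the midpoint \<open>(x + y) / 2\<close>, which stays in the ball by convexity, and substituting,
  one sees that doubling the admitted distance of \<open>x\<close> and \<open>y\<close> costs at most a factor
  \<open>2 ^ (d + 2)\<close>. About \<open>log\<^sub>2 r\<close> doublings lead from distance \<open>1\<close> to the diameter of the ball.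
  At distance at most \<open>1\<close> the jump kernel is at least \<open>1\<close>.
\<close>

section \<open>Quadratic deviation from the mean\<close>

lemma (in finite_measure) nn_integral_square_deviation_mean_le:
  fixes f :: "'a \<Rightarrow> real"
  assumes [measurable]: "f \<in> borel_measurable M" and bound: "\<And>x. x \<in> space M \<Longrightarrow> \<bar>f x\<bar> \<le> B"
  defines "m \<equiv> (LINT x|M. f x) / measure M (space M)"
  shows "(\<integral>\<^sup>+ x. ennreal ((f x - m)\<^sup>2) \<partial>M) \<le> (\<integral>\<^sup>+ x. ennreal ((f x - a)\<^sup>2) \<partial>M)"
proof -
  have int_f: "integrable M f"
    by (rule integrable_const_bound[where B = B]) (auto intro!: AE_I2 bound)
  have int_sq: "integrable M (\<lambda>x. (f x - b)\<^sup>2)" for b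
  proof (rule integrable_const_bound[where B = "(B + \<bar>b\<bar>)\<^sup>2"])
    show "AE x in M. norm ((f x - b)\<^sup>2) \<le> (B + \<bar>b\<bar>)\<^sup>2"
    proof (rule AE_I2)
      fix x assume "x \<in> space M"
      then have "\<bar>f x - b\<bar> \<le> B + \<bar>b\<bar>" using bound[of x] by linarith
      then have "\<bar>f x - b\<bar>\<^sup>2 \<le> (B + \<bar>b\<bar>)\<^sup>2" by (intro power_mono) auto
      then show "norm ((f x - b)\<^sup>2) \<le> (B + \<bar>b\<bar>)\<^sup>2" by simp
    qed
  qed simp
  \<comment> \<open>If the total mass is zero, \<open>m\<close> is 0 by the convention for division
    by zero, but the integral of \<open>f\<close> vanishes too, so the identity survives.\<close>
  have mean: "(LINT x|M. f x) = m * measure M (space M)"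
  proof (cases "measure M (space M) = 0")
    case True
    then have "AE x in M. False"
      by (intro AE_I[where N = "space M"]) (auto simp: emeasure_eq_measure)
    then have "(LINT x|M. f x) = (LINT x|M. 0)"
      by (intro integral_cong_AE) auto
    then show ?thesis using True by simp
  qed (simp add: m_def)
  \<comment> \<open>Moving the centre from \<open>m\<close> to \<open>a\<close> adds exactly (m -
    a)^2 times the total mass, because \<open>mean\<close> evaluates the linear term.\<close>
  have "(LINT x|M. (f x - a)\<^sup>2) = (LINT x|M. (f x - m)\<^sup>2 + (2 * (m - a) * f x + (a\<^sup>2 - m\<^sup>2)))"
    by (intro Bochner_Integration.integral_cong) (auto simp: power2_eq_square algebra_simps)
  also have "\<dots> = (LINT x|M. (f x - m)\<^sup>2)
      + (2 * (m - a) * (LINT x|M. f x) + (a\<^sup>2 - m\<^sup>2) * measure M (space M))"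
    using int_f int_sq[of m] by (simp add: mult.commute)
  also have "\<dots> = (LINT x|M. (f x - m)\<^sup>2) + (m - a)\<^sup>2 * measure M (space M)"
    unfolding mean by (simp add: power2_eq_square algebra_simps)
  also have "\<dots> \<ge> (LINT x|M. (f x - m)\<^sup>2)" by simp
  finally show ?thesis
    by (simp add: nn_integral_eq_integral int_sq ennreal_leI)
qed

lemma nn_integral_lborel_affine:
  fixes c :: real and t :: "'a::euclidean_space"
  assumes "c \<noteq> 0" and [measurable]: "h \<in> borel_measurable borel"
  shows "(\<integral>\<^sup>+ y. h y \<partial>lborel) = ennreal (\<bar>c\<bar> ^ DIM('a)) * (\<integral>\<^sup>+ y. h (t + c *\<^sub>R y) \<partial>lborel)"
  by (subst lborel_affine[OF assms(1), of t])
    (simp add: nn_integral_density nn_integral_distr nn_integral_cmult)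

text \<open>Lebesgue measure is used in both variables so that affine substitutions are available;
  the Gibbs weight enters only through its bounds before and after the doublings. A single indicator
  on pairs keeps the integrand symmetric and jointly measurable.\<close>

definition pair_energy :: "'a::euclidean_space set \<Rightarrow> ('a \<Rightarrow> real) \<Rightarrow> real \<Rightarrow> ennreal" where
  "pair_energy S f s =
     (\<integral>\<^sup>+ x. \<integral>\<^sup>+ y. ennreal ((f x - f y)\<^sup>2) *
        indicator {p. fst p \<in> S \<and> snd p \<in> S \<and> norm (fst p - snd p) \<le> s} (x, y) \<partial>lborel \<partial>lborel)"

text \<open>The factor is 2 * 2 * 2^d: one 2 from the inequality for squares, one from the two
  halves of the segment, and 2^d from the Jacobian of passing from \<open>y\<close> to the
  midpoint.\<close>

lemma pair_energy_double:
  fixes S :: "'a::euclidean_space set"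
  assumes "convex S" and [measurable]: "S \<in> sets borel" "f \<in> borel_measurable borel"
  shows "pair_energy S f (2 * s) \<le> 2 ^ (DIM('a) + 2) * pair_energy S f s"
proof -
  define g where "g t x y = ennreal ((f x - f y)\<^sup>2) *
    indicator {p. fst p \<in> S \<and> snd p \<in> S \<and> norm (fst p - snd p) \<le> t} (x, y)" for t x y
  have E: "pair_energy S f t = (\<integral>\<^sup>+ x. \<integral>\<^sup>+ y. g t x y \<partial>lborel \<partial>lborel)" for t
    unfolding pair_energy_def g_def ..
  have [measurable]: "(\<lambda>p. g t (fst p) (snd p)) \<in> borel_measurable (borel \<Otimes>\<^sub>M borel)" for t
    unfolding g_def by measurable
  have gm [measurable (raw)]: "(\<lambda>z. g t (u z) (v z)) \<in> borel_measurable M"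
    if "u \<in> borel_measurable M" "v \<in> borel_measurable M" for t u v and M :: "'b measure"
    using measurable_compose[OF measurable_Pair[OF that], of "\<lambda>p. g t (fst p) (snd p)"] by simp
  have pointwise: "g (2 * s) x y
      \<le> 2 * g s x ((1/2) *\<^sub>R (x + y)) + 2 * g s y ((1/2) *\<^sub>R (x + y))" for x y
  proof (cases "x \<in> S \<and> y \<in> S \<and> norm (x - y) \<le> 2 * s")
    case True
    define m where "m = (1/2) *\<^sub>R (x + y)"
    have "m \<in> S"
      using convexD[OF assms(1), of x y "1/2" "1/2"] True by (simp add: m_def scaleR_add_right)
    have "x - m = (1/2) *\<^sub>R (x - y)" "y - m = (1/2) *\<^sub>R (y - x)"
      by (simp_all add: m_def scaleR_add_right scaleR_diff_right)
        (metis add_diff_cancel_left' scaleR_half_double scaleR_add_right)+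
    then have "norm (x - m) \<le> s" "norm (y - m) \<le> s"
      using True by (simp_all add: norm_minus_commute)
    \<comment> \<open>The right side minus the left side is the square of f x + f y - 2 * f
      m.\<close>
    moreover have "(f x - f y)\<^sup>2 \<le> 2 * (f x - f m)\<^sup>2 + 2 * (f y - f m)\<^sup>2"
      using zero_le_power2[of "f x + f y - 2 * f m"] by (simp add: power2_eq_square algebra_simps)
    then have "ennreal ((f x - f y)\<^sup>2) \<le> ennreal (2 * (f x - f m)\<^sup>2 + 2 * (f y - f m)\<^sup>2)"
      by (rule ennreal_leI)
    then have "ennreal ((f x - f y)\<^sup>2)
        \<le> 2 * ennreal ((f x - f m)\<^sup>2) + 2 * ennreal ((f y - f m)\<^sup>2)"
      by (simp add: ennreal_mult')
    ultimately show ?thesis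
      using True \<open>m \<in> S\<close> unfolding g_def m_def[symmetric] by simp
  qed (simp add: g_def)
  \<comment> \<open>For fixed \<open>x\<close> the substitution y = - x + 2 w turns the midpoint
    into \<open>w\<close>. Both \<open>y\<close> and \<open>w\<close> run over the whole space, so
    this is an equality.\<close>
  have mid: "(\<integral>\<^sup>+ y. g s x ((1/2) *\<^sub>R (x + y)) \<partial>lborel) = 2 ^ DIM('a) * (\<integral>\<^sup>+ y. g s x y \<partial>lborel)"
    for x
  proof -
    have "(\<integral>\<^sup>+ y. g s x ((1/2) *\<^sub>R (x + y)) \<partial>lborel)
        = ennreal (\<bar>2\<bar> ^ DIM('a)) * (\<integral>\<^sup>+ w. g s x ((1/2) *\<^sub>R (x + (- x + 2 *\<^sub>R w))) \<partial>lborel)"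
      by (rule nn_integral_lborel_affine) auto
    then show ?thesis by (simp flip: ennreal_power)
  qed
  have "pair_energy S f (2 * s)
      \<le> (\<integral>\<^sup>+ x. \<integral>\<^sup>+ y. 2 * g s x ((1/2) *\<^sub>R (x + y)) + 2 * g s y ((1/2) *\<^sub>R (x + y)) \<partial>lborel \<partial>lborel)"
    unfolding E by (intro nn_integral_mono pointwise)
  also have "\<dots> = 2 * (\<integral>\<^sup>+ x. \<integral>\<^sup>+ y. g s x ((1/2) *\<^sub>R (x + y)) \<partial>lborel \<partial>lborel)
      + 2 * (\<integral>\<^sup>+ x. \<integral>\<^sup>+ y. g s y ((1/2) *\<^sub>R (x + y)) \<partial>lborel \<partial>lborel)"
    by (simp add: nn_integral_add nn_integral_cmult)
  \<comment> \<open>Exchanging the order of integration reduces the half ending at \<open>y\<close>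
    to the half starting at \<open>x\<close>.\<close>
  also have "(\<integral>\<^sup>+ x. \<integral>\<^sup>+ y. g s y ((1/2) *\<^sub>R (x + y)) \<partial>lborel \<partial>lborel)
      = (\<integral>\<^sup>+ y. \<integral>\<^sup>+ x. g s y ((1/2) *\<^sub>R (y + x)) \<partial>lborel \<partial>lborel)"
    by (subst lborel_pair.Fubini') (simp_all add: add.commute)
  also have "(\<integral>\<^sup>+ x. \<integral>\<^sup>+ y. g s x ((1/2) *\<^sub>R (x + y)) \<partial>lborel \<partial>lborel) = 2 ^ DIM('a) * pair_energy S f s"
    by (simp add: mid nn_integral_cmult E)
  finally show ?thesis
    by (simp add: power_add mult_ac flip: distrib_right)
qed

text \<open>Written as a power of the scale \<open>2 ^ j\<close>, the accumulated constant is
  polynomial in the radius once \<open>2 ^ j\<close> is comparable to it.\<close>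

lemma pair_energy_power2:
  fixes S :: "'a::euclidean_space set"
  assumes "convex S" "S \<in> sets borel" "f \<in> borel_measurable borel"
  shows "pair_energy S f (2 ^ j) \<le> (2 ^ j) ^ (DIM('a) + 2) * pair_energy S f 1"
proof (induction j)
  case (Suc j)
  have "pair_energy S f (2 ^ Suc j) \<le> 2 ^ (DIM('a) + 2) * pair_energy S f (2 ^ j)"
    using pair_energy_double[OF assms, of "2 ^ j"] by simp
  also have "\<dots> \<le> 2 ^ (DIM('a) + 2) * ((2 ^ j) ^ (DIM('a) + 2) * pair_energy S f 1)"
    by (intro mult_left_mono Suc.IH) simp
  finally show ?case by (simp only: power_Suc power_mult_distrib mult.assoc)
qed simp

lemma pair_energy_ball_le:
  fixes f :: "'a::euclidean_space \<Rightarrow> real"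
  assumes [measurable]: "f \<in> borel_measurable borel" and "1 < r"
  shows "(\<integral>\<^sup>+ x \<in> ball 0 r. \<integral>\<^sup>+ y \<in> ball 0 r. ennreal ((f x - f y)\<^sup>2) \<partial>lborel \<partial>lborel)
     \<le> ennreal ((4 * r) ^ (DIM('a) + 2)) * pair_energy (ball 0 r) f 1"
proof -
  \<comment> \<open>The diameter of the ball is \<open>2 * r\<close>. Rounding its logarithm up
    loses at most a factor 2, so \<open>2 ^ n\<close> lies between \<open>2 * r\<close> and
    \<open>4 * r\<close>.\<close>
  define n where "n = nat \<lceil>log 2 (2 * r)\<rceil>"
  have "0 \<le> log 2 (2 * r)" using assms(2) by simp
  then have n: "log 2 (2 * r) \<le> real n" "real n \<le> log 2 (2 * r) + 1"
    unfolding n_def by linarith+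
  have "2 * r = 2 powr log 2 (2 * r)" using assms(2) by simp
  also have "\<dots> \<le> 2 powr real n" using n by (intro powr_mono) auto
  finally have lo: "2 * r \<le> 2 ^ n" by (simp add: powr_realpow)
  have "2 powr real n \<le> 2 powr (log 2 (2 * r) + 1)" using n by (intro powr_mono) auto
  also have "\<dots> = 4 * r" using assms(2) by (simp add: powr_add)
  finally have hi: "2 ^ n \<le> 4 * r" by (simp add: powr_realpow)
  have "(\<integral>\<^sup>+ x \<in> ball 0 r. \<integral>\<^sup>+ y \<in> ball 0 r. ennreal ((f x - f y)\<^sup>2) \<partial>lborel \<partial>lborel)
      \<le> pair_energy (ball 0 r) f (2 ^ n)"
    unfolding pair_energy_def
  proof (intro nn_integral_mono)
    fix x :: 'a
    have "norm (x - y) \<le> 2 ^ n" if "x \<in> ball 0 r" "y \<in> ball 0 r" for y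
      using that lo norm_triangle_ineq4[of x y] by simp
    then show "(\<integral>\<^sup>+ y \<in> ball 0 r. ennreal ((f x - f y)\<^sup>2) \<partial>lborel) * indicator (ball 0 r) x
        \<le> (\<integral>\<^sup>+ y. ennreal ((f x - f y)\<^sup>2) * indicator {p. fst p \<in> ball 0 r \<and> snd p \<in> ball 0 r \<and>
             norm (fst p - snd p) \<le> 2 ^ n} (x, y) \<partial>lborel)"
      by (cases "x \<in> ball 0 r") (auto intro!: nn_integral_mono simp: indicator_def)
  qed
  also have "\<dots> \<le> (2 ^ n) ^ (DIM('a) + 2) * pair_energy (ball 0 r) f 1"
    by (rule pair_energy_power2) auto
  also have "(2 ^ n) ^ (DIM('a) + 2) = ennreal ((2 ^ n) ^ (DIM('a) + 2))"
    by (simp flip: ennreal_power del: add_2_eq_Suc')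
  also have "\<dots> * pair_energy (ball 0 r) f 1
      \<le> ennreal ((4 * r) ^ (DIM('a) + 2)) * pair_energy (ball 0 r) f 1"
    by (intro mult_right_mono ennreal_leI power_mono hi) auto
  finally show ?thesis .
qed

section \<open>Bounds on the density, and the Gibbs measure\<close>

lemma locally_bounded_imp_bounded_on_compact:
  assumes "locally_bounded V" "compact S"
  shows "bounded (V ` S)"
proof -
  obtain U where U: "\<And>x. open (U x)" "\<And>x. x \<in> U x" "\<And>x. bounded (V ` U x)"
    using assms(1) unfolding locally_bounded_def by metis
  obtain T where T: "finite T" "S \<subseteq> (\<Union>x\<in>T. U x)"
    by (rule compactE_image[OF assms(2), of S U]) (use U in auto)
  have "bounded (\<Union>x\<in>T. V ` U x)" using T U by (intro bounded_UN) auto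
  then show ?thesis by (rule bounded_subset) (use T in blast)
qed

text \<open>A real \<open>INF\<close> or \<open>SUP\<close> is informative only over a nonempty set
  bounded on the relevant side. Zero always bounds the exponential from below; the upper bound and
  the positivity of \<open>k_inf\<close> come from boundedness of \<open>V\<close> on closed
  balls.\<close>

lemma exp_bounds_on_ball:
  fixes V :: "real ^ 'n \<Rightarrow> real"
  assumes "locally_bounded V" "0 < r"
  shows "0 < k_inf V r" and "0 < K_sup V r"
    and "\<And>x. norm x \<le> r + 1 \<Longrightarrow> k_inf V r \<le> exp (- V x)"
    and "\<And>x. norm x \<le> r \<Longrightarrow> exp (- V x) \<le> K_sup V r"
proof -
  have "bounded (V ` cball 0 R)" for R
    using assms by (intro locally_bounded_imp_bounded_on_compact) auto
  then have "\<exists>B. \<forall>x. norm x \<le> R \<longrightarrow> \<bar>V x\<bar> \<le> B" for R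
    unfolding bounded_iff by fastforce
  then obtain B where B: "\<And>R x. norm x \<le> R \<Longrightarrow> \<bar>V x\<bar> \<le> B R" by metis
  have ge: "exp (- B R) \<le> exp (- V x)" and le: "exp (- V x) \<le> exp (B R)" if "norm x \<le> R" for x R
    using B[OF that] by auto
  have "exp (- B (r + 1)) \<le> k_inf V r"
    unfolding k_inf_def using assms(2) ge
    by (intro cINF_greatest) (auto intro!: exI[of _ 0])
  then show "0 < k_inf V r" by (rule less_le_trans[rotated]) simp
  show "k_inf V r \<le> exp (- V x)" if "norm x \<le> r + 1" for x
    unfolding k_inf_def using that by (intro cINF_lower) (auto intro!: bdd_belowI[of _ 0])
  show K: "exp (- V x) \<le> K_sup V r" if "norm x \<le> r" for x
    unfolding K_sup_def using that le
    by (intro cSUP_upper) (auto intro!: bdd_aboveI[of _ "exp (B r)"])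
  show "0 < K_sup V r" using K[of 0] assms(2) by (intro less_le_trans[OF exp_gt_zero]) auto
qed

lemma gibbs_const_pos:
  fixes V :: "real ^ 'n \<Rightarrow> real"
  assumes "integrable lborel (\<lambda>x. exp (- V x))"
  shows "0 < gibbs_const V"
proof -
  have "(LINT x|lborel. exp (- V x)) \<noteq> 0"
  proof
    assume "(LINT x|lborel. exp (- V x)) = 0"
    \<comment> \<open>A zero integral would force the strictly positive function exp (- V x) to
      vanish almost everywhere, but Lebesgue measure is not zero.\<close>
    then have "AE x in (lborel :: (real ^ 'n) measure). False"
      using assms by (subst (asm) integral_nonneg_eq_0_iff_AE) auto
    then show False by (simp add: eventually_False ae_filter_eq_bot_iff)
  qed
  moreover have "0 \<le> (LINT x|lborel. exp (- V x))" by simp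
  ultimately have "0 < (LINT x|lborel. exp (- V x))" by linarith
  then show ?thesis unfolding gibbs_const_def by simp
qed

text \<open>Finiteness makes bounded measurable functions integrable, so that the argument about the
  mean applies.\<close>

lemma finite_measure_gibbs:
  assumes "integrable lborel (\<lambda>x. exp (- V x))"
  shows "finite_measure (gibbs_measure V)"
proof (rule finite_measureI)
  have "(\<integral>\<^sup>+ x. ennreal (gibbs_const V * exp (- V x)) \<partial>lborel) \<noteq> \<infinity>"
    using integrable_mult_right[OF assms, of "gibbs_const V"] gibbs_const_pos[OF assms]
    by (subst nn_integral_eq_integral) (auto intro!: AE_I2)
  then show "emeasure (gibbs_measure V) (space (gibbs_measure V)) \<noteq> \<infinity>"
    using assms unfolding gibbs_measure_def
    by (subst emeasure_density) (auto dest: borel_measurable_integrable)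
qed

lemma Cb_infinity_measurable_bounded:
  assumes "f \<in> Cb_infinity"
  shows "f \<in> borel_measurable borel" and "\<exists>B. \<forall>x. \<bar>f x\<bar> \<le> B"
proof -
  \<comment> \<open>The empty list of derivatives gives the statements about \<open>f\<close>
    itself.\<close>
  have *: "\<forall>x. f differentiable (at x)" "bounded (range f)"
    using assms unfolding Cb_infinity_def by (force dest: spec[of _ "[]"])+
  have "continuous_on UNIV f"
    using *(1) by (simp add: continuous_at_imp_continuous_on differentiable_imp_continuous_within)
  then show "f \<in> borel_measurable borel" by (rule borel_measurable_continuous_onI)
  show "\<exists>B. \<forall>x. \<bar>f x\<bar> \<le> B" using *(2) unfolding bounded_iff by auto
qed

section \<open>From the variance to an unweighted double integral\<close>

lemma local_variance_le_deviation:
  fixes V :: "real ^ 'n \<Rightarrow> real"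
  assumes "integrable lborel (\<lambda>x. exp (- V x))"
    and [measurable]: "f \<in> borel_measurable borel" and bound: "\<And>x. \<bar>f x\<bar> \<le> B"
  shows "local_variance V r f \<le> (\<integral>\<^sup>+ x \<in> ball 0 r. ennreal ((f x - a)\<^sup>2) \<partial>gibbs_measure V)"
proof -
  have sets_eq [measurable_cong]: "sets (gibbs_measure V) = sets borel" and sp: "space (gibbs_measure V) = UNIV"
    by (simp_all add: gibbs_measure_def)
  interpret finite_measure "gibbs_measure V" by (rule finite_measure_gibbs) fact
  \<comment> \<open>After restriction the ball is the whole space, so the mean of \<open>f\<close>
    for this measure is \<open>ball_mean V r f\<close>.\<close>
  interpret R: finite_measure "restrict_space (gibbs_measure V) (ball 0 r)"
    by (rule finite_measure_restrict_space[OF finite_measure_gibbs[OF assms(1)]])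
      (simp add: gibbs_measure_def)
  have ball: "ball 0 r \<inter> space (gibbs_measure V) \<in> sets (gibbs_measure V)"
    by (simp add: sp gibbs_measure_def)
  have "f \<in> borel_measurable (restrict_space (gibbs_measure V) (ball 0 r))"
    by (intro measurable_restrict_space1) measurable
  from R.nn_integral_square_deviation_mean_le[OF this bound, of a] show ?thesis
    unfolding local_variance_def ball_mean_def
    by (simp add: nn_integral_restrict_space[OF ball] integral_restrict_space[OF ball]
        set_lebesgue_integral_def measure_restrict_space space_restrict_space sp sets_eq)
qed

text \<open>The first factor is the Lebesgue volume of the ball: the bound \<open>dev\<close> is
  integrated over \<open>y\<close>, on which its left side does not depend. As \<open>y\<close>
  carries no weight, only the variable \<open>x\<close> contributes a factor
  \<open>K_sup V r\<close>.\<close>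

lemma local_variance_le_pair_integral:
  fixes V :: "real ^ 'n \<Rightarrow> real"
  assumes "locally_bounded V"
    and [measurable]: "V \<in> borel_measurable borel"
    and int: "integrable lborel (\<lambda>x. exp (- V x))"
    and [measurable]: "f \<in> borel_measurable borel" and bound: "\<And>x. \<bar>f x\<bar> \<le> B" and "0 < r"
  shows "ennreal (unit_ball_vol CARD('n) * r ^ CARD('n)) * local_variance V r f
    \<le> ennreal (gibbs_const V * K_sup V r) *
      (\<integral>\<^sup>+ x \<in> ball 0 r. \<integral>\<^sup>+ y \<in> ball 0 r. ennreal ((f x - f y)\<^sup>2) \<partial>lborel \<partial>lborel)"
proof -
  have C: "0 < gibbs_const V" by (rule gibbs_const_pos) fact
  have [measurable]: "ball (0 :: real ^ 'n) r \<in> sets borel" by simp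
  have dev: "local_variance V r f \<le> ennreal (gibbs_const V * K_sup V r) *
      (\<integral>\<^sup>+ x \<in> ball 0 r. ennreal ((f y - f x)\<^sup>2) \<partial>lborel)" for y
  proof -
    have "local_variance V r f \<le> (\<integral>\<^sup>+ x \<in> ball 0 r. ennreal ((f x - f y)\<^sup>2) \<partial>gibbs_measure V)"
      by (rule local_variance_le_deviation[OF int _ bound]) simp
    also have "\<dots> = (\<integral>\<^sup>+ x. ennreal (gibbs_const V * exp (- V x)) *
        (ennreal ((f x - f y)\<^sup>2) * indicator (ball 0 r) x) \<partial>lborel)"
      unfolding gibbs_measure_def by (subst nn_integral_density) auto
    \<comment> \<open>The difference is reversed so that \<open>y\<close>, later the outer variable,
      comes first.\<close>
    also have "\<dots> \<le> (\<integral>\<^sup>+ x. ennreal (gibbs_const V * K_sup V r) *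
        (ennreal ((f y - f x)\<^sup>2) * indicator (ball 0 r) x) \<partial>lborel)"
      using C exp_bounds_on_ball(4)[OF assms(1) \<open>0 < r\<close>]
      by (intro nn_integral_mono)
        (auto simp: indicator_def power2_commute intro!: mult_right_mono ennreal_leI)
    finally show ?thesis by (simp add: nn_integral_cmult)
  qed
  have "ennreal (unit_ball_vol CARD('n) * r ^ CARD('n)) * local_variance V r f
      = (\<integral>\<^sup>+ y \<in> ball (0 :: real ^ 'n) r. local_variance V r f \<partial>lborel)"
    using \<open>0 < r\<close> by (simp add: nn_integral_cmult_indicator emeasure_ball mult.commute)
  also have "\<dots> \<le> (\<integral>\<^sup>+ y \<in> ball 0 r. ennreal (gibbs_const V * K_sup V r) *
      (\<integral>\<^sup>+ x \<in> ball 0 r. ennreal ((f y - f x)\<^sup>2) \<partial>lborel) \<partial>lborel)"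
    by (intro nn_integral_mono mult_right_mono dev) simp
  finally show ?thesis by (simp add: nn_integral_cmult mult.assoc)
qed

section \<open>From short distances to the jump energy\<close>

lemma square_le_jump_quotient:
  assumes "0 \<le> \<alpha>" "norm (x - y) \<le> 1"
  shows "(f x - f y)\<^sup>2 \<le> jump_quotient \<alpha> f x y"
proof (cases "x = y")
  case False
  \<comment> \<open>The norm lies in (0, 1] and the exponent is nonnegative, so the denominator is
    in (0, 1] and dividing by it cannot decrease the square.\<close>
  then have "norm (x - y) powr (real CARD('a) + \<alpha>) \<le> 1" "0 < norm (x - y) powr (real CARD('a) + \<alpha>)"
    using assms False by (auto intro!: powr_le1)
  moreover from this(1) have
    "(f x - f y)\<^sup>2 * norm (x - y) powr (real CARD('a) + \<alpha>) \<le> (f x - f y)\<^sup>2 * 1"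
    by (rule mult_left_mono) simp
  ultimately show ?thesis using assms(2) by (simp add: jump_quotient_def pos_le_divide_eq)
qed (simp add: jump_quotient_def)

lemma jump_quotient_measurable [measurable]:
  assumes [measurable]: "f \<in> borel_measurable borel"
  shows "(\<lambda>p. jump_quotient \<alpha> f (fst p) (snd p)) \<in> borel_measurable (borel \<Otimes>\<^sub>M borel)"
  unfolding jump_quotient_def by measurable

text \<open>Enlarging the ball to radius \<open>r + 1\<close> only adds nonnegative terms, and that
  is the radius over which \<open>k_inf V r\<close> takes its infimum, so it bounds the weight from
  below on the larger ball.\<close>

lemma pair_energy_le_local_energy:
  fixes V :: "real ^ 'n \<Rightarrow> real"
  assumes "0 \<le> \<alpha>" "locally_bounded V" and [measurable]: "V \<in> borel_measurable borel"
    and int: "integrable lborel (\<lambda>x. exp (- V x))"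
    and [measurable]: "f \<in> borel_measurable borel" and "0 < r"
  shows "ennreal (gibbs_const V * k_inf V r) * pair_energy (ball 0 r) f 1
    \<le> local_energy \<alpha> V (r + 1) f"
proof -
  have C: "0 < gibbs_const V" by (rule gibbs_const_pos) fact
  have [measurable]: "ball (0 :: real ^ 'n) R \<in> sets borel" for R by simp
  define J where "J x = (\<integral>\<^sup>+ y \<in> ball 0 (r + 1). ennreal (jump_quotient \<alpha> f x y) \<partial>lborel)" for x
  have [measurable]: "J \<in> borel_measurable borel"
  proof -
    have "(\<lambda>p. ennreal (jump_quotient \<alpha> f (fst p) (snd p)) * indicator (ball 0 (r + 1)) (snd p))
        \<in> borel_measurable (borel \<Otimes>\<^sub>M lborel)" by measurable
    from lborel.borel_measurable_nn_integral_fst[OF this] show ?thesis by (simp add: J_def[abs_def])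
  qed
  have "pair_energy (ball 0 r) f 1 \<le> (\<integral>\<^sup>+ x \<in> ball 0 (r + 1). J x \<partial>lborel)"
    unfolding pair_energy_def
  proof (intro nn_integral_mono)
    fix x :: "real ^ 'n"
    show "(\<integral>\<^sup>+ y. ennreal ((f x - f y)\<^sup>2) * indicator {p. fst p \<in> ball 0 r \<and> snd p \<in> ball 0 r \<and>
             norm (fst p - snd p) \<le> 1} (x, y) \<partial>lborel) \<le> J x * indicator (ball 0 (r + 1)) x"
      using assms(1) square_le_jump_quotient[of \<alpha> x _ f] unfolding J_def
      by (cases "x \<in> ball 0 r") (auto intro!: nn_integral_mono ennreal_leI simp: indicator_def)
  qed
  then have "ennreal (gibbs_const V * k_inf V r) * pair_energy (ball 0 r) f 1
      \<le> ennreal (gibbs_const V * k_inf V r) * (\<integral>\<^sup>+ x \<in> ball 0 (r + 1). J x \<partial>lborel)"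
    by (rule mult_left_mono) simp
  also have "\<dots> = (\<integral>\<^sup>+ x. ennreal (gibbs_const V * k_inf V r) *
      (J x * indicator (ball 0 (r + 1)) x) \<partial>lborel)"
    by (simp add: nn_integral_cmult)
  also have "\<dots> \<le> (\<integral>\<^sup>+ x. ennreal (gibbs_const V * exp (- V x)) *
      (J x * indicator (ball 0 (r + 1)) x) \<partial>lborel)"
    using C exp_bounds_on_ball(3)[OF assms(2) \<open>0 < r\<close>]
    by (intro nn_integral_mono) (auto simp: indicator_def intro!: mult_right_mono ennreal_leI)
  also have "\<dots> = local_energy \<alpha> V (r + 1) f"
    unfolding local_energy_def gibbs_measure_def J_def[symmetric]
    by (subst nn_integral_density) auto
  finally show ?thesis .
qed

text \<open>Removing the restriction to the ball enlarges both integrals; the 2 cancels the 1 / 2 in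
  \<open>dirichlet_form\<close>.\<close>

lemma local_energy_le_dirichlet_form:
  "local_energy \<alpha> V R f \<le> 2 * dirichlet_form \<alpha> V f"
proof -
  have "local_energy \<alpha> V R f
      \<le> (\<integral>\<^sup>+ x. (\<integral>\<^sup>+ y. ennreal (jump_quotient \<alpha> f x y) \<partial>lborel) \<partial>gibbs_measure V)"
    unfolding local_energy_def
  proof (intro nn_integral_mono)
    fix x
    have "(\<integral>\<^sup>+ y \<in> ball 0 R. ennreal (jump_quotient \<alpha> f x y) \<partial>lborel)
        \<le> (\<integral>\<^sup>+ y. ennreal (jump_quotient \<alpha> f x y) \<partial>lborel)"
      by (intro nn_integral_mono) (auto simp: indicator_def)
    then show "(\<integral>\<^sup>+ y \<in> ball 0 R. ennreal (jump_quotient \<alpha> f x y) \<partial>lborel) * indicator (ball 0 R) x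
        \<le> (\<integral>\<^sup>+ y. ennreal (jump_quotient \<alpha> f x y) \<partial>lborel)"
      by (auto simp: indicator_def)
  qed
  moreover have "ennreal 2 * ennreal (1 / 2) = 1"
    by (subst ennreal_mult[symmetric]) auto
  then have "2 * (ennreal (1 / 2) * e) = e" for e
    by (simp only: mult.assoc[symmetric] ennreal_numeral mult_1)
  ultimately show ?thesis unfolding dirichlet_form_def by simp
qed

section \<open>The explicit constant and the theorem\<close>

lemma ennreal_le_divide_mult:
  assumes "0 < p" "ennreal p * v \<le> ennreal q * e"
  shows "v \<le> ennreal (q / p) * e"
proof -
  \<comment> \<open>Only the finite positive factor \<open>p\<close> is cancelled, so
    \<open>v\<close> and \<open>e\<close> may be infinite.\<close>
  have "v = ennreal (inverse p) * (ennreal p * v)"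
    using assms(1) by (simp add: mult.assoc[symmetric] flip: ennreal_mult)
  also have "\<dots> \<le> ennreal (inverse p) * (ennreal q * e)" by (intro mult_left_mono assms(2)) simp
  also have "\<dots> = ennreal (inverse p * q) * e"
    using assms(1) by (simp add: mult.assoc[symmetric] ennreal_mult')
  finally show ?thesis by (simp add: divide_inverse mult.commute)
qed

lemma local_variance_le_local_energy:
  fixes V :: "real ^ 'n \<Rightarrow> real"
  assumes "0 \<le> \<alpha>" "locally_bounded V" "V \<in> borel_measurable borel"
    and int: "integrable lborel (\<lambda>x. exp (- V x))"
    and f: "f \<in> borel_measurable borel" "\<And>x. \<bar>f x\<bar> \<le> B" and "1 < r"
  shows "local_variance V r f
    \<le> ennreal (4 ^ (CARD('n) + 2) / unit_ball_vol CARD('n) * K_sup V r * r ^ (3 * CARD('n)) / k_inf V r)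
      * local_energy \<alpha> V (r + 1) f"
proof -
  let ?d = "CARD('n)"
  define b C k K where "b = unit_ball_vol (real ?d)" and "C = gibbs_const V"
    and "k = k_inf V r" and "K = K_sup V r"
  have r: "0 < r" using assms by simp
  have pos: "0 < b" "0 < C" "0 < k" "0 < K"
    using exp_bounds_on_ball(1,2)[OF assms(2) r] gibbs_const_pos[OF int]
    by (simp_all add: b_def C_def k_def K_def)
  have "ennreal (C * k) * pair_energy (ball 0 r) f 1 \<le> ennreal 1 * local_energy \<alpha> V (r + 1) f"
    using pair_energy_le_local_energy[OF assms(1-3) int f(1) r] by (simp add: C_def k_def)
  then have "pair_energy (ball 0 r) f 1 \<le> ennreal (1 / (C * k)) * local_energy \<alpha> V (r + 1) f"
    using pos by (intro ennreal_le_divide_mult) auto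
  moreover have "ennreal (b * r ^ ?d) * local_variance V r f
      \<le> ennreal (C * K) * (ennreal ((4 * r) ^ (?d + 2)) * pair_energy (ball 0 r) f 1)"
    using local_variance_le_pair_integral[OF assms(2,3) int f r]
      pair_energy_ball_le[OF f(1) assms(7)]
    unfolding b_def C_def K_def by (auto elim!: order_trans intro!: mult_left_mono)
  ultimately have "ennreal (b * r ^ ?d) * local_variance V r f \<le> ennreal (C * K) *
      (ennreal ((4 * r) ^ (?d + 2)) * (ennreal (1 / (C * k)) * local_energy \<alpha> V (r + 1) f))"
    by (elim order_trans) (auto intro!: mult_left_mono)
  also have "\<dots> = ennreal (C * K * (4 * r) ^ (?d + 2) * (1 / (C * k))) * local_energy \<alpha> V (r + 1) f"
  proof -
    have "ennreal p * (ennreal q * (ennreal s * e)) = ennreal (p * q * s) * e"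
      if "0 \<le> p" "0 \<le> q" "0 \<le> s" for p q s e
      using that by (simp add: ennreal_mult mult.assoc)
    then show ?thesis using pos r by (simp del: ennreal_1)
  qed
  finally have "local_variance V r f \<le>
      ennreal (C * K * (4 * r) ^ (?d + 2) * (1 / (C * k)) / (b * r ^ ?d)) * local_energy \<alpha> V (r + 1) f"
    using pos r by (intro ennreal_le_divide_mult) auto
  \<comment> \<open>The normalising constant \<open>C\<close> cancels, and the volume of the ball
    absorbs r^d out of r^(d + 2), leaving only r^2.\<close>
  also have "C * K * (4 * r) ^ (?d + 2) * (1 / (C * k)) / (b * r ^ ?d) = 4 ^ (?d + 2) / b * K * r ^ 2 / k"
    using pos r by (simp add: field_simps power_mult_distrib power_add power2_eq_square)
  also have "ennreal (4 ^ (?d + 2) / b * K * r ^ 2 / k) * local_energy \<alpha> V (r + 1) f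
      \<le> ennreal (4 ^ (?d + 2) / b * K * r ^ (3 * ?d) / k) * local_energy \<alpha> V (r + 1) f"
  proof -
    \<comment> \<open>The dimension is at least 1 and r > 1, so r^2 is at most r^(3 d).\<close>
    have "2 \<le> 3 * ?d" using zero_less_card_finite[where 'a = 'n] by linarith
    then have "r ^ 2 \<le> r ^ (3 * ?d)" using assms(7) by (intro power_increasing) auto
    then show ?thesis
      using pos by (intro mult_right_mono ennreal_leI divide_right_mono mult_left_mono) auto
  qed
  finally show ?thesis by (simp add: b_def k_def K_def)
qed

text \<open>The comparison of the two energies carries a factor 2 because
  \<open>local_energy\<close> lacks the 1 / 2 of \<open>dirichlet_form\<close>. The last conjunct
  nevertheless bounds the variance by the Dirichlet form with the same \<open>c\<close>.\<close>

theorem proposition2p3: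
  fixes \<alpha> :: real and V :: "real ^ 'n \<Rightarrow> real"
  assumes "0 < \<alpha>" and "\<alpha> < 2"
    and "locally_bounded V"
    and "V \<in> borel_measurable borel"
    and "integrable lborel (\<lambda>x. exp (- V x))"
  shows "\<exists>C\<^sub>3 > 0. \<forall>r > 1. \<forall>f \<in> Cb_infinity.
    (let c = ennreal (C\<^sub>3 * K_sup V r * r ^ (3 * CARD('n)) / k_inf V r) in
      local_variance V r f \<le> c * local_energy \<alpha> V (r + 1) f \<and>
      c * local_energy \<alpha> V (r + 1) f \<le> 2 * (c * dirichlet_form \<alpha> V f) \<and>
      local_variance V r f \<le> c * dirichlet_form \<alpha> V f)"
proof -
  define A where "A = 4 ^ (CARD('n) + 2) / unit_ball_vol (real CARD('n))"
  have A: "0 < A" by (simp add: A_def)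
  show ?thesis
  \<comment> \<open>The constant \<open>A\<close> already suffices against
    \<open>local_energy\<close>; doubling it absorbs the factor 2 in passing to
    \<open>dirichlet_form\<close>.\<close>
  proof (intro exI[of _ "2 * A"] conjI allI impI ballI, goal_cases)
    case (2 r f)
    let ?E = "local_energy \<alpha> V (r + 1) f" and ?D = "dirichlet_form \<alpha> V f"
    define a where "a = ennreal (A * K_sup V r * r ^ (3 * CARD('n)) / k_inf V r)"
    obtain B where "\<And>x. \<bar>f x\<bar> \<le> B" using Cb_infinity_measurable_bounded(2)[OF 2(2)] by blast
    then have var: "local_variance V r f \<le> a * ?E"
      using assms 2 Cb_infinity_measurable_bounded(1)[OF 2(2)]
      unfolding a_def A_def by (intro local_variance_le_local_energy) auto
    have c: "ennreal (2 * A * K_sup V r * r ^ (3 * CARD('n)) / k_inf V r) = 2 * a"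
      unfolding a_def by (simp add: ennreal_mult' mult.assoc flip: times_divide_eq_right)
    have ED: "?E \<le> 2 * ?D" by (rule local_energy_le_dirichlet_form)
    have "a * ?E \<le> 2 * a * ?E"
      by (intro mult_right_mono) (simp_all add: mult_2)
    moreover have "2 * a * ?E \<le> 2 * (2 * a * ?D)"
      using mult_left_mono[OF ED, of "2 * a"] by (simp add: mult_ac)
    moreover have "a * ?E \<le> 2 * a * ?D"
      using mult_left_mono[OF ED, of a] by (simp add: mult_ac)
    ultimately show ?case unfolding Let_def c using var by (meson order_trans)
  qed (use A in simp)
qed

end
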